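(* Let $X$ and $Y$ be F-$\mathbb{BC}$ modules and let $T:X\to Y$ be a surjective closed $\mathbb{BC}$-linear map. Then $T$ is $\mathbb{D}$-bounded and $T$ is an open map.
   Context: Bicomplex and hyperbolic numbers. $\mathbb{BC}=\{z_1+z_2 j : z_1,z_2\in\mathbb{C}(i)\}$ with $i^2=j^2=-1$, $ij=ji=k$ (so $k^2=1$); it is a commutative ring. $\mathbb{D}=\{\beta_1+k\beta_2:\beta_1,\beta_2\in\mathbb{R}\}\subset\mathbb{BC}$ is the ring of hyperbolic numbers. With $e_1=\frac{1+k}{2}$, $e_2=\frac{1-k}{2}$ one has $e_1^2=e_1$, $e_2^2=e_2$, $e_1+e_2=1$, $e_1e_2=0$, and each $Z\in\mathbb{BC}$ is uniquely $Z=e_1z_1+e_2z_2$ with $z_1,z_2\in\mathbb{C}(i)$; $Z\in\mathbb{D}$ iff $z_1,z_2$ are real. Put $|Z|_k=e_1|z_1|+e_2|z_2|$. Let $\mathbb{D}^+=\{e_1\alpha_1+e_2\alpha_2:\alpha_1,\alpha_2\ge 0\}$; an element is strictly positive if $\alpha_1,\alpha_2>0$. The partial order on $\mathbb{D}$ is $\alpha\le\beta$ iff $\beta-\alpha\in\mathbb{D}^+$. Convergence in $\mathbb{D}$ is componentwise with respect to $e_1,e_2$. Norms. A hyperbolic norm on a $\mathbb{BC}$-module $X$ is a map $\|\cdot\|_{\mathbb{D}}:X\to\mathbb{D}^+$ with $\|x\|_{\mathbb{D}}=0$ iff $x=0$; $\|\mu x\|_{\mathbb{D}}=|\mu|_k\|x\|_{\mathbb{D}}$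 for $\mu\in\mathbb{BC}$; and $\|x+y\|_{\mathbb{D}}\le\|x\|_{\mathbb{D}}+\|y\|_{\mathbb{D}}$. $x_n\to x$ means $\|x_n-x\|_{\mathbb{D}}\to 0$ in $\mathbb{D}$; the topology of $X$ has as base the open balls $B(a,r)=\{x: r-\|x-a\|_{\mathbb{D}}\text{ is strictly positive}\}$, $a\in X$, $r\in\mathbb{D}^+$ strictly positive. An F-$\mathbb{BC}$ module is a $\mathbb{BC}$-module with a hyperbolic norm for which every Cauchy sequence converges. Maps. $T:X\to Y$ is $\mathbb{BC}$-linear if $T(x+y)=T(x)+T(y)$ and $T(\mu x)=\mu T(x)$ for $x,y\in X$, $\mu\in\mathbb{BC}$. A $\mathbb{BC}$-linear map $T$ is closed if its graph is closed in $X\times Y$, i.e. whenever $x_n\to x$ in $X$ and $Tx_n\to y$ in $Y$, then $Tx=y$. $T$ is $\mathbb{D}$-bounded if there is $M\in\mathbb{D}^+$ with $\|T(x)\|_{\mathbb{D}}\le M\|x\|_{\mathbb{D}}$ for all $x\in X$. $T$ is open if it maps open sets to open sets. *)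

theory Defs
  imports "HOL-Analysis.Analysis"
begin

section \<open>Bicomplex numbers\<close>

text \<open>\<open>Bicomplex z1 z2\<close> stands for \<open>z1 + z2 j\<close>; the imaginary unit of type \<^typ>\<open>complex\<close> plays
  the role of \<open>i\<close>.\<close>

datatype bicomplex = Bicomplex (bc_fst: complex) (bc_snd: complex)

lemma bicomplex_eq_iff: "Z = W \<longleftrightarrow> bc_fst Z = bc_fst W \<and> bc_snd Z = bc_snd W"
  by (cases Z; cases W) simp

instantiation bicomplex :: comm_ring_1
begin

definition zero_bicomplex :: bicomplex where "0 = Bicomplex 0 0"

definition one_bicomplex :: bicomplex where "1 = Bicomplex 1 0"

definition plus_bicomplex :: "bicomplex \<Rightarrow> bicomplex \<Rightarrow> bicomplex" where
  "Z + W = Bicomplex (bc_fst Z + bc_fst W) (bc_snd Z + bc_snd W)"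

definition minus_bicomplex :: "bicomplex \<Rightarrow> bicomplex \<Rightarrow> bicomplex" where
  "Z - W = Bicomplex (bc_fst Z - bc_fst W) (bc_snd Z - bc_snd W)"

definition uminus_bicomplex :: "bicomplex \<Rightarrow> bicomplex" where
  "- Z = Bicomplex (- bc_fst Z) (- bc_snd Z)"

definition times_bicomplex :: "bicomplex \<Rightarrow> bicomplex \<Rightarrow> bicomplex" where
  "Z * W = Bicomplex (bc_fst Z * bc_fst W - bc_snd Z * bc_snd W)
                     (bc_fst Z * bc_snd W + bc_snd Z * bc_fst W)"

instance
  by standard
    (simp_all add: bicomplex_eq_iff zero_bicomplex_def one_bicomplex_def plus_bicomplex_def
      minus_bicomplex_def uminus_bicomplex_def times_bicomplex_def algebra_simps)

end

lemmas bicomplex_defs = zero_bicomplex_def one_bicomplex_def plus_bicomplex_def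
  minus_bicomplex_def uminus_bicomplex_def times_bicomplex_def

definition bc_of_complex :: "complex \<Rightarrow> bicomplex" where
  "bc_of_complex z = Bicomplex z 0"

abbreviation bc_of_real :: "real \<Rightarrow> bicomplex" where
  "bc_of_real a \<equiv> bc_of_complex (complex_of_real a)"

definition bc_i :: bicomplex where "bc_i = bc_of_complex \<i>"

definition bc_j :: bicomplex where "bc_j = Bicomplex 0 1"

definition bc_k :: bicomplex where "bc_k = bc_i * bc_j"

definition bc_e1 :: bicomplex where "bc_e1 = bc_of_complex (1/2) * (1 + bc_k)"

definition bc_e2 :: bicomplex where "bc_e2 = bc_of_complex (1/2) * (1 - bc_k)"

text \<open>The coefficients of the idempotent representation, characterised by
  \<open>idempotent_representation\<close> below.\<close>

definition bc_proj1 :: "bicomplex \<Rightarrow> complex" where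
  "bc_proj1 Z = bc_fst Z - \<i> * bc_snd Z"

definition bc_proj2 :: "bicomplex \<Rightarrow> complex" where
  "bc_proj2 Z = bc_fst Z + \<i> * bc_snd Z"

lemma bicomplex_standard_form:
  "Bicomplex z w = bc_of_complex z + bc_of_complex w * bc_j"
  by (simp add: bicomplex_defs bc_of_complex_def bc_j_def)

lemma bc_units:
  "bc_i * bc_i = -1" "bc_j * bc_j = -1" "bc_j * bc_i = bc_k" "bc_k * bc_k = 1"
  by (simp_all add: bicomplex_defs bc_of_complex_def bc_i_def bc_j_def bc_k_def)

lemma bc_idempotents:
  "bc_e1 * bc_e1 = bc_e1" "bc_e2 * bc_e2 = bc_e2" "bc_e1 + bc_e2 = 1" "bc_e1 * bc_e2 = 0"
  by (simp_all add: bicomplex_defs bc_of_complex_def bc_i_def bc_j_def bc_k_def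
      bc_e1_def bc_e2_def)

lemma idempotent_representation:
  "Z = bc_e1 * bc_of_complex z1 + bc_e2 * bc_of_complex z2 \<longleftrightarrow> z1 = bc_proj1 Z \<and> z2 = bc_proj2 Z"
proof -
  have e: "bc_e1 = Bicomplex (1/2) (\<i>/2)" "bc_e2 = Bicomplex (1/2) (-\<i>/2)"
    by (simp_all add: bicomplex_defs bc_of_complex_def bc_i_def bc_j_def bc_k_def
        bc_e1_def bc_e2_def)
  show ?thesis
    by (cases Z) (auto simp: e bicomplex_defs bc_of_complex_def bc_proj1_def bc_proj2_def
        complex_eq_iff field_simps)
qed

lemma bc_proj_idempotent:
  "bc_proj1 (bc_e1 * bc_of_complex a + bc_e2 * bc_of_complex b) = a"
  "bc_proj2 (bc_e1 * bc_of_complex a + bc_e2 * bc_of_complex b) = b"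
  using idempotent_representation[of "bc_e1 * bc_of_complex a + bc_e2 * bc_of_complex b" a b]
  by simp_all

lemma bc_proj_simps [simp]:
  "bc_proj1 0 = 0" "bc_proj2 0 = 0" "bc_proj1 1 = 1" "bc_proj2 1 = 1"
  "bc_proj1 (Z + W) = bc_proj1 Z + bc_proj1 W" "bc_proj2 (Z + W) = bc_proj2 Z + bc_proj2 W"
  "bc_proj1 (Z - W) = bc_proj1 Z - bc_proj1 W" "bc_proj2 (Z - W) = bc_proj2 Z - bc_proj2 W"
  "bc_proj1 (- Z) = - bc_proj1 Z" "bc_proj2 (- Z) = - bc_proj2 Z"
  "bc_proj1 (Z * W) = bc_proj1 Z * bc_proj1 W" "bc_proj2 (Z * W) = bc_proj2 Z * bc_proj2 W"
  by (simp_all add: bicomplex_defs bc_proj1_def bc_proj2_def algebra_simps)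

section \<open>Hyperbolic numbers\<close>

definition hyperbolic :: "bicomplex set" where
  "hyperbolic = {bc_of_real b1 + bc_k * bc_of_real b2 | b1 b2. True}"

definition hyp_nonneg :: "bicomplex set" where
  "hyp_nonneg = {bc_e1 * bc_of_real a1 + bc_e2 * bc_of_real a2 | a1 a2. 0 \<le> a1 \<and> 0 \<le> a2}"

definition hyp_pos :: "bicomplex set" where
  "hyp_pos = {bc_e1 * bc_of_real a1 + bc_e2 * bc_of_real a2 | a1 a2. 0 < a1 \<and> 0 < a2}"

definition hyp_le :: "bicomplex \<Rightarrow> bicomplex \<Rightarrow> bool" where
  "hyp_le a b \<longleftrightarrow> a \<in> hyperbolic \<and> b \<in> hyperbolic \<and> b - a \<in> hyp_nonneg"

definition bc_abs_k :: "bicomplex \<Rightarrow> bicomplex" where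
  "bc_abs_k Z = bc_e1 * bc_of_real (cmod (bc_proj1 Z)) + bc_e2 * bc_of_real (cmod (bc_proj2 Z))"

definition hyp_tendsto :: "(nat \<Rightarrow> bicomplex) \<Rightarrow> bicomplex \<Rightarrow> bool" where
  "hyp_tendsto s l \<longleftrightarrow>
     (\<lambda>n. bc_proj1 (s n)) \<longlonglongrightarrow> bc_proj1 l \<and> (\<lambda>n. bc_proj2 (s n)) \<longlonglongrightarrow> bc_proj2 l"

lemma hyp_nonneg_iff:
  "Z \<in> hyp_nonneg \<longleftrightarrow>
     bc_proj1 Z \<in> \<real> \<and> bc_proj2 Z \<in> \<real> \<and> 0 \<le> Re (bc_proj1 Z) \<and> 0 \<le> Re (bc_proj2 Z)"
  by (auto simp: hyp_nonneg_def idempotent_representation complex_is_Real_iff complex_eq_iff)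

lemma hyp_pos_iff:
  "Z \<in> hyp_pos \<longleftrightarrow>
     bc_proj1 Z \<in> \<real> \<and> bc_proj2 Z \<in> \<real> \<and> 0 < Re (bc_proj1 Z) \<and> 0 < Re (bc_proj2 Z)"
  by (auto simp: hyp_pos_def idempotent_representation complex_is_Real_iff complex_eq_iff)

lemma hyperbolic_iff: "Z \<in> hyperbolic \<longleftrightarrow> bc_proj1 Z \<in> \<real> \<and> bc_proj2 Z \<in> \<real>"
proof
  assume "Z \<in> hyperbolic"
  then show "bc_proj1 Z \<in> \<real> \<and> bc_proj2 Z \<in> \<real>"
    by (auto simp: hyperbolic_def bicomplex_defs bc_k_def bc_i_def bc_j_def bc_of_complex_def
        bc_proj1_def bc_proj2_def)
next
  assume "bc_proj1 Z \<in> \<real> \<and> bc_proj2 Z \<in> \<real>"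
  then obtain a b where ab: "bc_proj1 Z = complex_of_real a" "bc_proj2 Z = complex_of_real b"
    by (auto simp: Reals_def)
  have "Z = bc_of_real ((a + b) / 2) + bc_k * bc_of_real ((a - b) / 2)"
    using ab
    by (cases Z) (auto simp: bicomplex_defs bc_k_def bc_i_def bc_j_def bc_of_complex_def
        bc_proj1_def bc_proj2_def complex_eq_iff field_simps)
  then show "Z \<in> hyperbolic"
    unfolding hyperbolic_def by blast
qed

section \<open>Hyperbolic norms and F-BC modules\<close>

locale hyperbolic_normed_module = module scale
  for scale :: "bicomplex \<Rightarrow> 'a::ab_group_add \<Rightarrow> 'a" +
  fixes hnorm :: "'a \<Rightarrow> bicomplex"
  assumes hnorm_nonneg: "hnorm x \<in> hyp_nonneg"
    and hnorm_eq_0_iff: "hnorm x = 0 \<longleftrightarrow> x = 0"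
    and hnorm_scale: "hnorm (scale c x) = bc_abs_k c * hnorm x"
    and hnorm_triangle: "hyp_le (hnorm (x + y)) (hnorm x + hnorm y)"

definition hn_tendsto :: "('a::ab_group_add \<Rightarrow> bicomplex) \<Rightarrow> (nat \<Rightarrow> 'a) \<Rightarrow> 'a \<Rightarrow> bool" where
  "hn_tendsto hnorm s x \<longleftrightarrow> hyp_tendsto (\<lambda>n. hnorm (s n - x)) 0"

definition hn_Cauchy :: "('a::ab_group_add \<Rightarrow> bicomplex) \<Rightarrow> (nat \<Rightarrow> 'a) \<Rightarrow> bool" where
  "hn_Cauchy hnorm s \<longleftrightarrow>
     (\<forall>\<epsilon>\<in>hyp_pos. \<exists>n0. \<forall>m\<ge>n0. \<forall>n\<ge>n0. \<epsilon> - hnorm (s m - s n) \<in> hyp_pos)"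

definition hn_ball :: "('a::ab_group_add \<Rightarrow> bicomplex) \<Rightarrow> 'a \<Rightarrow> bicomplex \<Rightarrow> 'a set" where
  "hn_ball hnorm a r = {x. r - hnorm (x - a) \<in> hyp_pos}"

text \<open>\<^const>\<open>topology\<close> is only meaningful on predicates satisfying \<^const>\<open>istopology\<close>; that the
  unions of balls do so for a hyperbolic norm is lemma \<open>openin_hn_topology\<close> below.\<close>

definition hn_topology :: "('a::ab_group_add \<Rightarrow> bicomplex) \<Rightarrow> 'a topology" where
  "hn_topology hnorm =
     topology (arbitrary union_of (\<lambda>B. \<exists>a. \<exists>r\<in>hyp_pos. B = hn_ball hnorm a r))"

locale F_BC_module = hyperbolic_normed_module scale hnorm
  for scale :: "bicomplex \<Rightarrow> 'a::ab_group_add \<Rightarrow> 'a" and hnorm :: "'a \<Rightarrow> bicomplex" +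
  assumes complete: "hn_Cauchy hnorm s \<Longrightarrow> \<exists>x. hn_tendsto hnorm s x"

definition closed_graph_map ::
  "('a::ab_group_add \<Rightarrow> bicomplex) \<Rightarrow> ('b::ab_group_add \<Rightarrow> bicomplex) \<Rightarrow> ('a \<Rightarrow> 'b) \<Rightarrow> bool" where
  "closed_graph_map hnX hnY T \<longleftrightarrow>
     (\<forall>s x y. hn_tendsto hnX s x \<and> hn_tendsto hnY (\<lambda>n. T (s n)) y \<longrightarrow> T x = y)"

definition D_bounded ::
  "('a::ab_group_add \<Rightarrow> bicomplex) \<Rightarrow> ('b::ab_group_add \<Rightarrow> bicomplex) \<Rightarrow> ('a \<Rightarrow> 'b) \<Rightarrow> bool" where
  "D_bounded hnX hnY T \<longleftrightarrow> (\<exists>M\<in>hyp_nonneg. \<forall>x. hyp_le (hnY (T x)) (M * hnX x))"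

context hyperbolic_normed_module
begin

lemma hn_ball_iff:
  "r \<in> hyp_pos \<Longrightarrow> x \<in> hn_ball hnorm a r \<longleftrightarrow>
     Re (bc_proj1 (hnorm (x - a))) < Re (bc_proj1 r) \<and>
     Re (bc_proj2 (hnorm (x - a))) < Re (bc_proj2 r)"
  using hnorm_nonneg[of "x - a"] by (auto simp: hn_ball_def hyp_pos_iff hyp_nonneg_iff)

lemma hnorm_triangle_components:
  "Re (bc_proj1 (hnorm (x + y))) \<le> Re (bc_proj1 (hnorm x)) + Re (bc_proj1 (hnorm y))"
  "Re (bc_proj2 (hnorm (x + y))) \<le> Re (bc_proj2 (hnorm x)) + Re (bc_proj2 (hnorm y))"
  using hnorm_triangle[of x y] by (auto simp: hyp_le_def hyp_nonneg_iff)

lemma hn_ball_Int: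
  assumes r: "r \<in> hyp_pos" "s \<in> hyp_pos"
    and x: "x \<in> hn_ball hnorm a r" "x \<in> hn_ball hnorm b s"
  shows "\<exists>t\<in>hyp_pos. x \<in> hn_ball hnorm x t \<and> hn_ball hnorm x t \<subseteq> hn_ball hnorm a r \<inter> hn_ball hnorm b s"
proof -
  define t1 where "t1 = min (Re (bc_proj1 r) - Re (bc_proj1 (hnorm (x - a))))
                            (Re (bc_proj1 s) - Re (bc_proj1 (hnorm (x - b))))"
  define t2 where "t2 = min (Re (bc_proj2 r) - Re (bc_proj2 (hnorm (x - a))))
                            (Re (bc_proj2 s) - Re (bc_proj2 (hnorm (x - b))))"
  define t where "t = bc_e1 * bc_of_real t1 + bc_e2 * bc_of_real t2"
  have pos: "t1 > 0" "t2 > 0"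
    using x r by (auto simp: t1_def t2_def hn_ball_iff)
  have t: "t \<in> hyp_pos"
    using pos unfolding t_def hyp_pos_def by blast
  have tp: "Re (bc_proj1 t) = t1" "Re (bc_proj2 t) = t2"
    unfolding t_def bc_proj_idempotent by simp_all
  have "hnorm 0 = 0"
    using hnorm_eq_0_iff by blast
  then have "x \<in> hn_ball hnorm x t"
    using pos by (simp add: hn_ball_iff[OF t] tp)
  moreover have "y \<in> hn_ball hnorm a r \<inter> hn_ball hnorm b s" if "y \<in> hn_ball hnorm x t" for y
    using that hnorm_triangle_components[of "y - x" "x - a"]
      hnorm_triangle_components[of "y - x" "x - b"]
    by (auto simp: hn_ball_iff r t tp) (auto simp: t1_def t2_def)
  ultimately show ?thesis
    using t by blast
qed

lemma openin_hn_topology: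
  "openin (hn_topology hnorm) =
     arbitrary union_of (\<lambda>B. \<exists>a. \<exists>r\<in>hyp_pos. B = hn_ball hnorm a r)"
proof -
  let ?Q = "\<lambda>B. \<exists>a. \<exists>r\<in>hyp_pos. B = hn_ball hnorm a r"
  have "(arbitrary union_of ?Q) (S \<inter> T)"
    if S: "(arbitrary union_of ?Q) S" and T: "(arbitrary union_of ?Q) T" for S T
    unfolding arbitrary_union_of_alt
  proof
    fix x assume x: "x \<in> S \<inter> T"
    obtain a r where ar: "r \<in> hyp_pos" "x \<in> hn_ball hnorm a r" "hn_ball hnorm a r \<subseteq> S"
      using S x unfolding arbitrary_union_of_alt by blast
    obtain b s where bs: "s \<in> hyp_pos" "x \<in> hn_ball hnorm b s" "hn_ball hnorm b s \<subseteq> T"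
      using T x unfolding arbitrary_union_of_alt by blast
    show "\<exists>U. ?Q U \<and> x \<in> U \<and> U \<subseteq> S \<inter> T"
      using hn_ball_Int[OF ar(1) bs(1) ar(2) bs(2)] ar(3) bs(3) by blast
  qed
  then have "istopology (arbitrary union_of ?Q)"
    unfolding istopology_def by (auto intro: arbitrary_union_of_Union)
  then show ?thesis
    unfolding hn_topology_def by (rule topology_inverse')
qed

lemma topspace_hn_topology [simp]: "topspace (hn_topology hnorm) = UNIV"
proof -
  have one: "1 \<in> hyp_pos"
    by (simp add: hyp_pos_iff)
  have "hnorm 0 = 0"
    using hnorm_eq_0_iff by blast
  then have "x \<in> hn_ball hnorm x 1" for x
    using one by (simp add: hn_ball_iff)
  then have "openin (hn_topology hnorm) UNIV"
    unfolding openin_hn_topology arbitrary_union_of_alt using one by blast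
  then show ?thesis
    by (simp add: openin_subset top.extremum_uniqueI)
qed

end

end

theory Submission
  imports Defs
begin

text \<open>With \<open>n\<^sub>1, n\<^sub>2\<close> the two idempotent components of a hyperbolic norm, \<open>max n\<^sub>1 n\<^sub>2\<close> is a
  complete real norm inducing the same convergence and the same topology. A Baire category
  argument shows that a closed linear relation between Banach spaces whose domain is everything
  admits a selection that is bounded by a multiple of the norm. Applied to the graph of \<open>T\<close> this
  gives boundedness, and applied to the converse of the graph it gives openness. Since \<open>T\<close>
  commutes with the idempotents, boundedness for the real norm descends to both components.\<close>

section \<open>Baire category and geometric series in complete real normed spaces\<close>

locale complete_normed_vs = vector_space sc
  for sc :: "real \<Rightarrow> 'a::ab_group_add \<Rightarrow> 'a" +
  fixes nrm :: "'a \<Rightarrow> real"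
  assumes nrm_eq_0_iff: "nrm x = 0 \<longleftrightarrow> x = 0"
    and nrm_scale: "nrm (sc c x) = \<bar>c\<bar> * nrm x"
    and nrm_triangle: "nrm (x + y) \<le> nrm x + nrm y"
    and nrm_complete:
      "(\<And>e. e > 0 \<Longrightarrow> \<exists>n0. \<forall>m\<ge>n0. \<forall>n\<ge>n0. nrm (s m - s n) < e) \<Longrightarrow>
        \<exists>x. (\<lambda>n. nrm (s n - x)) \<longlonglongrightarrow> 0"
begin

lemma nrm_zero [simp]: "nrm 0 = 0"
  by (simp add: nrm_eq_0_iff)

lemma nrm_minus: "nrm (- x) = nrm x"
  using nrm_scale[of "-1" x] by simp

lemma nrm_nonneg: "nrm x \<ge> 0"
  using nrm_triangle[of x "- x"] by (simp add: nrm_minus)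

lemma nrm_diff_commute: "nrm (x - y) = nrm (y - x)"
  using nrm_minus[of "x - y"] by simp

lemma nrm_diff_le: "nrm (x - y) \<le> nrm x + nrm y"
  using nrm_triangle[of x "- y"] by (simp add: nrm_minus)

lemma nrm_diff_triangle: "nrm (x - z) \<le> nrm (x - y) + nrm (y - z)"
  using nrm_triangle[of "x - y" "y - z"] by simp

text \<open>The metric makes Baire's theorem for complete metric spaces available for a norm given
  as a parameter.\<close>

sublocale nm: Metric_space UNIV "\<lambda>x y. nrm (x - y)"
  by unfold_locales
    (auto simp: nrm_nonneg nrm_eq_0_iff nrm_diff_commute nrm_diff_triangle)

lemma mcomplete_nm: "nm.mcomplete"
  unfolding nm.mcomplete_def
proof (intro allI impI)
  fix s assume "nm.MCauchy s"
  then have "\<exists>x. (\<lambda>n. nrm (s n - x)) \<longlonglongrightarrow> 0"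
    by (intro nrm_complete) (simp add: nm.MCauchy_def)
  then show "\<exists>x. limitin nm.mtopology s x sequentially"
    by (simp add: nm.limitin_metric_dist_null)
qed

text \<open>Differences of two elements of the set turn the ball supplied by Baire's theorem into a
  ball about the origin.\<close>

lemma Baire_dense_differences:
  fixes A :: "nat \<Rightarrow> 'a set"
  assumes cover: "(\<Union>n. A n) = UNIV"
  shows "\<exists>n. \<exists>r>0. \<forall>x e. nrm x < r \<longrightarrow> e > 0 \<longrightarrow> (\<exists>a\<in>A n. \<exists>b\<in>A n. nrm (x - (a - b)) < e)"
proof -
  let ?cl = "\<lambda>n. nm.mtopology closure_of (A n)"
  \<comment> \<open>Otherwise countably many closed sets with empty interior would cover the whole
    space, against Baire's theorem.\<close>
  have "\<exists>n. nm.mtopology interior_of (?cl n) \<noteq> {}"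
  proof (rule ccontr)
    assume "\<nexists>n. nm.mtopology interior_of (?cl n) \<noteq> {}"
    then have "nm.mtopology interior_of (\<Union>(range ?cl)) = {}"
      by (intro nm.metric_Baire_category_alt mcomplete_nm) auto
    moreover have "\<Union>(range ?cl) = UNIV"
    proof -
      have "A n \<subseteq> ?cl n" for n
        by (intro closure_of_subset) simp
      then have "(\<Union>n. A n) \<subseteq> (\<Union>n. ?cl n)"
        by (intro UN_mono) auto
      then show ?thesis
        unfolding cover by (rule top.extremum_uniqueI)
    qed
    ultimately show False
      using interior_of_topspace[of nm.mtopology] by simp
  qed
  then obtain n x0 where "x0 \<in> nm.mtopology interior_of (?cl n)"
    by blast
  then obtain U where U: "openin nm.mtopology U" "x0 \<in> U" "U \<subseteq> ?cl n"
    unfolding interior_of_def by blast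
  then obtain r where r: "r > 0" "nm.mball x0 r \<subseteq> ?cl n"
    unfolding nm.openin_mtopology by blast
  have approx: "\<exists>a\<in>A n. nrm (y - a) < e" if "nrm (x0 - y) < r" "e > 0" for y e
  proof -
    have "y \<in> ?cl n"
      using r that by (auto simp: nm.mball_def)
    then show ?thesis
      using \<open>e > 0\<close> by (auto simp: nm.metric_closure_of nm.mball_def)
  qed
  have "\<exists>a\<in>A n. \<exists>b\<in>A n. nrm (x - (a - b)) < e" if "nrm x < r" "e > 0" for x e
  proof -
    \<comment> \<open>\<open>x\<close> is the difference of \<open>x0 + x\<close> and
      \<open>x0\<close>. Both lie in the ball, so each is within \<open>e / 2\<close> of a point of
      \<open>A n\<close>.\<close>
    have "nrm (x0 - (x0 + x)) < r" "nrm (x0 - x0) < r" "e / 2 > 0"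
      using that r(1) by (simp_all add: nrm_minus)
    then obtain a b where a: "a \<in> A n" "nrm (x0 + x - a) < e / 2"
      and b: "b \<in> A n" "nrm (x0 - b) < e / 2"
      using approx by meson
    have "x - (a - b) = (x0 + x - a) - (x0 - b)"
      by (simp add: algebra_simps)
    then have "nrm (x - (a - b)) < e"
      using a(2) b(2) nrm_diff_le[of "x0 + x - a" "x0 - b"] by (simp only:)
    then show ?thesis
      using a b by blast
  qed
  then show ?thesis
    using r by blast
qed

text \<open>The increments are dominated by a geometric series of sum \<open>2 * L\<close>, so the
  sequence is Cauchy. As it starts at 0, the bound on the partial sums passes to the limit.\<close>

lemma geometric_increments_converge:
  assumes s0: "s 0 = 0" and L: "\<And>n. nrm (s (Suc n) - s n) \<le> L / 2 ^ n"
  shows "\<exists>x. (\<lambda>n. nrm (s n - x)) \<longlonglongrightarrow> 0 \<and> nrm x \<le> 2 * L"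
proof -
  have L0: "L \<ge> 0"
    using order.trans[OF nrm_nonneg L[of 0]] by simp
  \<comment> \<open>The right-hand side is the exact sum of \<open>L / 2 ^ i\<close> for
    \<open>n \<le> i < n + k\<close>. Keeping the subtracted term is what lets the induction
    close.\<close>
  have tail: "nrm (s (n + k) - s n) \<le> 2 * L / 2 ^ n - 2 * L / 2 ^ (n + k)" for n k
  proof (induction k)
    case (Suc k)
    have "nrm (s (n + Suc k) - s n) \<le> nrm (s (Suc (n + k)) - s (n + k)) + nrm (s (n + k) - s n)"
      using nrm_diff_triangle[of "s (Suc (n + k))" "s n" "s (n + k)"] by simp
    also have "\<dots> \<le> L / 2 ^ (n + k) + (2 * L / 2 ^ n - 2 * L / 2 ^ (n + k))"
      using L Suc by (intro add_mono)
    also have "\<dots> = 2 * L / 2 ^ n - 2 * L / 2 ^ (n + Suc k)"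
      by (simp add: field_simps)
    finally show ?case .
  qed simp
  have tail': "nrm (s m - s n) \<le> 2 * L / 2 ^ n" if "n \<le> m" for m n
    using order.trans[OF tail[of n "m - n"], of "2 * L / 2 ^ n"] that L0 by simp
  have lim0: "(\<lambda>n. 2 * L / 2 ^ n) \<longlonglongrightarrow> 0"
    by (rule LIMSEQ_divide_realpow_zero) simp
  have "\<exists>x. (\<lambda>n. nrm (s n - x)) \<longlonglongrightarrow> 0"
  proof (rule nrm_complete)
    fix e :: real assume "e > 0"
    then obtain n0 where n0: "\<And>n. n \<ge> n0 \<Longrightarrow> 2 * L / 2 ^ n < e"
      using order_tendstoD(2)[OF lim0] unfolding eventually_sequentially by blast
    have "nrm (s m - s n) < e" if "m \<ge> n0" "n \<ge> n0" for m n
    proof (cases "n \<le> m")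
      case True
      show ?thesis
        by (rule order.strict_trans1[OF tail'[OF True] n0[OF that(2)]])
    next
      case False
      then have "m \<le> n"
        by simp
      from order.strict_trans1[OF tail'[OF this] n0[OF that(1)]] show ?thesis
        by (simp only: nrm_diff_commute[of "s m"])
    qed
    then show "\<exists>n0. \<forall>m\<ge>n0. \<forall>n\<ge>n0. nrm (s m - s n) < e"
      by blast
  qed
  then obtain x where x: "(\<lambda>n. nrm (s n - x)) \<longlonglongrightarrow> 0"
    by blast
  have "nrm x \<le> 2 * L + nrm (s n - x)" for n
    using tail'[of 0 n] nrm_diff_le[of "s n" "s n - x"] s0 by simp
  then have "nrm x \<le> 2 * L + 0"
    using x by (intro LIMSEQ_le_const[OF tendsto_add[OF tendsto_const x]]) auto
  then show ?thesis
    using x by auto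
qed

end

section \<open>Bounded selections of closed linear relations\<close>

text \<open>Baire's theorem yields only approximate solutions: some related pair has its first entry
  within half the norm of \<open>x\<close>, at controlled cost. Correcting the remainder repeatedly
  gives a geometric series of values, and closedness turns its sum into an exact solution.\<close>

theorem closed_relation_bounded_selection:
  fixes scX :: "real \<Rightarrow> 'a::ab_group_add \<Rightarrow> 'a" and scY :: "real \<Rightarrow> 'b::ab_group_add \<Rightarrow> 'b"
    and R :: "('a \<times> 'b) set"
  assumes X: "complete_normed_vs scX nX" and Y: "complete_normed_vs scY nY"
    and add: "\<And>x y x' y'. (x, y) \<in> R \<Longrightarrow> (x', y') \<in> R \<Longrightarrow> (x + x', y + y') \<in> R"
    and scale: "\<And>c x y. (x, y) \<in> R \<Longrightarrow> (scX c x, scY c y) \<in> R"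
    and total: "Domain R = UNIV"
    and closed: "\<And>s t x y. (\<And>n. (s n, t n) \<in> R) \<Longrightarrow> (\<lambda>n. nX (s n - x)) \<longlonglongrightarrow> 0 \<Longrightarrow>
      (\<lambda>n. nY (t n - y)) \<longlonglongrightarrow> 0 \<Longrightarrow> (x, y) \<in> R"
  shows "\<exists>C\<ge>0. \<forall>x. \<exists>y. (x, y) \<in> R \<and> nY y \<le> C * nX x"
proof -
  interpret X: complete_normed_vs scX nX by (rule X)
  interpret Y: complete_normed_vs scY nY by (rule Y)
  have zero: "(0, 0) \<in> R"
  proof -
    obtain x y where "(x, y) \<in> R"
      using total by blast
    from scale[OF this, of 0] show ?thesis
      by simp
  qed
  have diff: "(x - x', y - y') \<in> R" if "(x, y) \<in> R" "(x', y') \<in> R" for x y x' y'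
    using add[OF that(1) scale[OF that(2), of "-1"]] by simp
  \<comment> \<open>Totality of \<open>R\<close> makes these sets cover the space, since each point
    has some value and its norm lies below some natural number.\<close>
  define A where "A n = {x. \<exists>y. (x, y) \<in> R \<and> nY y \<le> real n}" for n :: nat
  have "(\<Union>n. A n) = UNIV"
  proof -
    have "\<exists>n. x \<in> A n" for x
    proof -
      obtain y where y: "(x, y) \<in> R"
        using total by (auto simp: Domain_iff set_eq_iff)
      obtain n where "nY y \<le> real n"
        using real_arch_simple by blast
      then show ?thesis
        using y by (auto simp: A_def)
    qed
    then show ?thesis by blast
  qed
  then obtain n r where r: "r > 0" and
    dense: "\<And>x e. nX x < r \<Longrightarrow> e > 0 \<Longrightarrow> \<exists>a\<in>A n. \<exists>b\<in>A n. nX (x - (a - b)) < e"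
    using X.Baire_dense_differences by metis
  \<comment> \<open>A difference of two points of \<open>A n\<close> has a related value of norm at
    most \<open>2 * n\<close>. Scaling back by \<open>c = 2 * nX x / r\<close> below makes this
    \<open>K * nX x\<close>.\<close>
  define K where "K = 4 * real n / r"
  have K0: "K \<ge> 0"
    using r by (simp add: K_def)
  have step: "\<exists>a b. (a, b) \<in> R \<and> nY b \<le> K * nX x \<and> nX (x - a) \<le> nX x / 2" for x
  proof (cases "x = 0")
    case True
    then show ?thesis
      using zero by (intro exI[of _ 0]) simp
  next
    case False
    then have pos: "nX x > 0"
      using X.nrm_nonneg[of x] X.nrm_eq_0_iff[of x] by linarith
    \<comment> \<open>Dividing by \<open>c\<close> brings \<open>x\<close> to norm
      \<open>r / 2\<close>, inside the ball of approximable points. An error of \<open>r / 4\<close>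
      there becomes \<open>nX x / 2\<close> after scaling back.\<close>
    define c where "c = 2 * nX x / r"
    have c: "c > 0"
      using pos r by (simp add: c_def)
    have "nX (scX (1 / c) x) < r"
      using pos r c by (simp add: X.nrm_scale c_def field_simps)
    then obtain a b where ab: "a \<in> A n" "b \<in> A n" "nX (scX (1 / c) x - (a - b)) < r / 4"
      using dense[of "scX (1 / c) x" "r / 4"] r by auto
    obtain u v where uv: "(a, u) \<in> R" "nY u \<le> real n" "(b, v) \<in> R" "nY v \<le> real n"
      using ab by (auto simp: A_def)
    have "(scX c (a - b), scY c (u - v)) \<in> R"
      by (intro scale diff uv)
    moreover have "nY (scY c (u - v)) \<le> K * nX x"
    proof -
      have "nY (u - v) \<le> 2 * real n"
        using Y.nrm_diff_le[of u v] uv by linarith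
      then have "c * nY (u - v) \<le> c * (2 * real n)"
        using c by (intro mult_left_mono) auto
      also have "\<dots> = K * nX x"
        by (simp add: c_def K_def)
      finally show ?thesis
        using c by (simp add: Y.nrm_scale)
    qed
    moreover have "nX (x - scX c (a - b)) \<le> nX x / 2"
    proof -
      have "x - scX c (a - b) = scX c (scX (1 / c) x - (a - b))"
        using c by (simp add: X.scale_right_diff_distrib)
      then have "nX (x - scX c (a - b)) = c * nX (scX (1 / c) x - (a - b))"
        using c by (simp add: X.nrm_scale)
      also have "\<dots> \<le> c * (r / 4)"
        using c ab by (intro mult_left_mono) auto
      also have "\<dots> = nX x / 2"
        using r by (simp add: c_def)
      finally show ?thesis .
    qed
    ultimately show ?thesis by blast
  qed
  then obtain f g where fg: "\<And>x. (f x, g x) \<in> R" "\<And>x. nY (g x) \<le> K * nX x"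
    "\<And>x. nX (x - f x) \<le> nX x / 2"
    by metis
  have "\<exists>y. (x, y) \<in> R \<and> nY y \<le> 2 * K * nX x" for x
  proof -
    \<comment> \<open>\<open>z k\<close> is the remainder after \<open>k\<close> corrections and
      \<open>t k\<close> the sum of the values spent on them. By linearity \<open>t k\<close> is
      related to \<open>x - z k\<close>.\<close>
    define z where "z k = ((\<lambda>u. u - f u) ^^ k) x" for k
    define t where "t k = (\<Sum>i<k. g (z i))" for k
    have z_Suc: "z (Suc k) = z k - f (z k)" and z_0: "z 0 = x" for k
      by (simp_all add: z_def)
    have nz: "nX (z k) \<le> nX x / 2 ^ k" for k
    proof (induction k)
      case (Suc k)
      show ?case
        using fg(3)[of "z k"] Suc by (simp add: z_Suc)
    qed (simp add: z_0)
    have mem: "(x - z k, t k) \<in> R" for k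
    proof (induction k)
      case (Suc k)
      have eq: "x - z (Suc k) = (x - z k) + f (z k)"
        by (simp add: z_Suc)
      then show ?case
        using add[OF Suc fg(1)[of "z k"]] by (simp only: eq t_def sum.lessThan_Suc)
    qed (simp add: zero z_0 t_def)
    have "nY (t (Suc k) - t k) \<le> K * nX x / 2 ^ k" for k
      using order.trans[OF fg(2)[of "z k"] mult_left_mono[OF nz[of k] K0]] by (simp add: t_def)
    then obtain y where y: "(\<lambda>k. nY (t k - y)) \<longlonglongrightarrow> 0" "nY y \<le> 2 * (K * nX x)"
      using Y.geometric_increments_converge[of t "K * nX x"] by (auto simp: t_def)
    have "(\<lambda>k. nX x / 2 ^ k) \<longlonglongrightarrow> 0"
      by (rule LIMSEQ_divide_realpow_zero) simp
    then have "(\<lambda>k. nX (x - z k - x)) \<longlonglongrightarrow> 0"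
      by (rule tendsto_sandwich[rotated 3])
        (auto simp: X.nrm_minus X.nrm_nonneg nz)
    \<comment> \<open>The remainders vanish, so \<open>x - z k\<close> tends to \<open>x\<close>
      while \<open>t k\<close> tends to \<open>y\<close>.\<close>
    then have "(x, y) \<in> R"
      using closed[OF mem _ y(1)] by blast
    then show ?thesis
      using y(2) by auto
  qed
  then show ?thesis
    using K0 by (intro exI[of _ "2 * K"]) auto
qed

section \<open>The real norm of an F-BC module\<close>

context hyperbolic_normed_module
begin

definition hn1 :: "'a \<Rightarrow> real" where "hn1 x = Re (bc_proj1 (hnorm x))"

definition hn2 :: "'a \<Rightarrow> real" where "hn2 x = Re (bc_proj2 (hnorm x))"

definition real_norm :: "'a \<Rightarrow> real" where "real_norm x = max (hn1 x) (hn2 x)"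

definition real_scale :: "real \<Rightarrow> 'a \<Rightarrow> 'a" where "real_scale c = scale (bc_of_real c)"

lemma bc_proj_hnorm:
  "bc_proj1 (hnorm x) = complex_of_real (hn1 x)" "bc_proj2 (hnorm x) = complex_of_real (hn2 x)"
  using hnorm_nonneg[of x] by (auto simp: hyp_nonneg_iff hn1_def hn2_def)

lemma hn_nonneg: "hn1 x \<ge> 0" "hn2 x \<ge> 0"
  using hnorm_nonneg[of x] by (auto simp: hyp_nonneg_iff hn1_def hn2_def)

lemma hn_scale:
  "hn1 (scale c x) = cmod (bc_proj1 c) * hn1 x" "hn2 (scale c x) = cmod (bc_proj2 c) * hn2 x"
  by (simp_all add: hn1_def hn2_def hnorm_scale bc_abs_k_def bc_proj_idempotent
      del: bc_proj_simps(5,6))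

text \<open>Multiplication by an idempotent keeps one component and kills the other. An estimate in
  \<open>real_norm\<close> can thus be split into one estimate per component.\<close>

lemma real_norm_idempotent:
  "real_norm (scale bc_e1 x) = hn1 x" "real_norm (scale bc_e2 x) = hn2 x"
proof -
  have "bc_proj1 bc_e1 = 1" "bc_proj2 bc_e1 = 0" "bc_proj1 bc_e2 = 0" "bc_proj2 bc_e2 = 1"
    by (simp_all add: bc_proj1_def bc_proj2_def bicomplex_defs bc_of_complex_def bc_i_def bc_j_def
        bc_k_def bc_e1_def bc_e2_def)
  then show "real_norm (scale bc_e1 x) = hn1 x" "real_norm (scale bc_e2 x) = hn2 x"
    by (simp_all add: real_norm_def hn_scale hn_nonneg max_absorb1 max_absorb2)
qed

text \<open>The maximum of two null sequences is null. Conversely, each component is nonnegative and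
  dominated by the maximum.\<close>

lemma hn_tendsto_iff_real_norm:
  "hn_tendsto hnorm s x \<longleftrightarrow> (\<lambda>n. real_norm (s n - x)) \<longlonglongrightarrow> 0"
proof -
  have of_real0: "(\<lambda>n. complex_of_real (f n)) \<longlonglongrightarrow> 0 \<longleftrightarrow> f \<longlonglongrightarrow> 0" for f :: "nat \<Rightarrow> real"
    by (metis of_real_0 tendsto_of_real_iff)
  have "hn_tendsto hnorm s x \<longleftrightarrow> (\<lambda>n. hn1 (s n - x)) \<longlonglongrightarrow> 0 \<and> (\<lambda>n. hn2 (s n - x)) \<longlonglongrightarrow> 0"
    by (simp add: hn_tendsto_def hyp_tendsto_def bc_proj_hnorm of_real0)
  also have "\<dots> \<longleftrightarrow> (\<lambda>n. real_norm (s n - x)) \<longlonglongrightarrow> 0"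
  proof
    assume "(\<lambda>n. hn1 (s n - x)) \<longlonglongrightarrow> 0 \<and> (\<lambda>n. hn2 (s n - x)) \<longlonglongrightarrow> 0"
    then have "(\<lambda>n. max (hn1 (s n - x)) (hn2 (s n - x))) \<longlonglongrightarrow> max 0 0"
      by (intro tendsto_max) auto
    then show "(\<lambda>n. real_norm (s n - x)) \<longlonglongrightarrow> 0"
      by (simp add: real_norm_def)
  next
    assume lim: "(\<lambda>n. real_norm (s n - x)) \<longlonglongrightarrow> 0"
    show "(\<lambda>n. hn1 (s n - x)) \<longlonglongrightarrow> 0 \<and> (\<lambda>n. hn2 (s n - x)) \<longlonglongrightarrow> 0"
      by (intro conjI tendsto_sandwich[OF _ _ tendsto_const lim])
        (auto simp: hn_nonneg real_norm_def)
  qed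
  finally show ?thesis .
qed

lemma openin_hn_topology_iff_real_norm:
  "openin (hn_topology hnorm) U \<longleftrightarrow> (\<forall>x\<in>U. \<exists>d>0. \<forall>y. real_norm (y - x) < d \<longrightarrow> y \<in> U)"
proof (intro iffI ballI)
  fix x assume U: "openin (hn_topology hnorm) U" "x \<in> U"
  then obtain a r where ar: "r \<in> hyp_pos" "x \<in> hn_ball hnorm a r" "hn_ball hnorm a r \<subseteq> U"
    unfolding openin_hn_topology arbitrary_union_of_alt by blast
  \<comment> \<open>Intersecting the ball with itself recentres it at \<open>x\<close>.\<close>
  then obtain t where t: "t \<in> hyp_pos" "hn_ball hnorm x t \<subseteq> U"
    using hn_ball_Int[OF ar(1) ar(1) ar(2) ar(2)] by blast
  define d where "d = min (Re (bc_proj1 t)) (Re (bc_proj2 t))"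
  have "y \<in> U" if "real_norm (y - x) < d" for y
    using that t by (auto simp: d_def real_norm_def hn1_def hn2_def hn_ball_iff)
  moreover have "d > 0"
    using t by (simp add: d_def hyp_pos_iff)
  ultimately show "\<exists>d>0. \<forall>y. real_norm (y - x) < d \<longrightarrow> y \<in> U"
    by blast
next
  assume U: "\<forall>x\<in>U. \<exists>d>0. \<forall>y. real_norm (y - x) < d \<longrightarrow> y \<in> U"
  show "openin (hn_topology hnorm) U"
    unfolding openin_hn_topology arbitrary_union_of_alt
  proof
    fix x assume "x \<in> U"
    then obtain d where d: "d > 0" "\<And>y. real_norm (y - x) < d \<Longrightarrow> y \<in> U"
      using U by blast
    \<comment> \<open>With equal components the hyperbolic ball is exactly the real ball of radius
      \<open>d\<close>.\<close>
    define t where "t = bc_e1 * bc_of_real d + bc_e2 * bc_of_real d"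
    have t: "t \<in> hyp_pos"
      using d unfolding t_def hyp_pos_def by blast
    have tp: "Re (bc_proj1 t) = d" "Re (bc_proj2 t) = d"
      unfolding t_def bc_proj_idempotent by simp_all
    have "hnorm 0 = 0"
      using hnorm_eq_0_iff by blast
    then have "x \<in> hn_ball hnorm x t"
      using d by (simp add: hn_ball_iff[OF t] tp)
    moreover have "hn_ball hnorm x t \<subseteq> U"
      using d(2) by (auto simp: hn_ball_iff[OF t] tp real_norm_def hn1_def hn2_def)
    ultimately show "\<exists>V. (\<exists>a. \<exists>r\<in>hyp_pos. V = hn_ball hnorm a r) \<and> x \<in> V \<and> V \<subseteq> U"
      using t by blast
  qed
qed

end

text \<open>Both components of a real scalar \<open>c\<close> have modulus
  \<open>\<bar>c\<bar>\<close>, which gives homogeneity. Completeness is inherited because a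
  hyperbolic tolerance may be replaced by its smaller component.\<close>

lemma (in F_BC_module) complete_normed_vs_real_norm: "complete_normed_vs real_scale real_norm"
proof
  have proj: "bc_proj1 (bc_of_real c) = of_real c" "bc_proj2 (bc_of_real c) = of_real c" for c
    by (simp_all add: bc_proj1_def bc_proj2_def bc_of_complex_def)
  have hom: "bc_of_real (a + b) = bc_of_real a + bc_of_real b"
    "bc_of_real (a * b) = bc_of_real a * bc_of_real b" "bc_of_real 1 = 1" for a b
    by (simp_all add: bc_of_complex_def bicomplex_defs)
  fix a b c :: real and x y :: 'a and s :: "nat \<Rightarrow> 'a"
  show "real_scale a (x + y) = real_scale a x + real_scale a y"
    by (simp add: real_scale_def scale_right_distrib)
  show "real_scale (a + b) x = real_scale a x + real_scale b x"
    by (simp only: real_scale_def hom scale_left_distrib)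
  show "real_scale a (real_scale b x) = real_scale (a * b) x"
    by (simp only: real_scale_def hom scale_scale)
  show "real_scale 1 x = x"
    by (simp only: real_scale_def hom scale_one)
  show "real_norm x = 0 \<longleftrightarrow> x = 0"
  proof
    assume "real_norm x = 0"
    then have "hn1 x = 0" "hn2 x = 0"
      using hn_nonneg[of x] by (auto simp: real_norm_def max_def split: if_splits)
    then have "hnorm x = 0"
      using idempotent_representation[of "hnorm x" 0 0] idempotent_representation[of 0 0 0]
      by (simp add: bc_proj_hnorm)
    then show "x = 0"
      by (simp add: hnorm_eq_0_iff)
  next
    assume "x = 0"
    then have "hnorm x = 0"
      by (simp add: hnorm_eq_0_iff)
    then show "real_norm x = 0"
      by (simp add: real_norm_def hn1_def hn2_def)
  qed
  show "real_norm (real_scale c x) = \<bar>c\<bar> * real_norm x"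
    by (simp add: real_norm_def real_scale_def hn_scale proj max_mult_distrib_left)
  show "real_norm (x + y) \<le> real_norm x + real_norm y"
    using hnorm_triangle_components[of x y] by (auto simp: real_norm_def hn1_def hn2_def)
  assume Cauchy: "\<And>e. e > 0 \<Longrightarrow> \<exists>n0. \<forall>m\<ge>n0. \<forall>n\<ge>n0. real_norm (s m - s n) < e"
  have "hn_Cauchy hnorm s"
    unfolding hn_Cauchy_def
  proof
    fix \<epsilon> assume \<epsilon>: "\<epsilon> \<in> hyp_pos"
    define e where "e = min (Re (bc_proj1 \<epsilon>)) (Re (bc_proj2 \<epsilon>))"
    have "e > 0"
      using \<epsilon> by (simp add: e_def hyp_pos_iff)
    then obtain n0 where n0: "\<forall>m\<ge>n0. \<forall>n\<ge>n0. real_norm (s m - s n) < e"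
      using Cauchy by blast
    have "\<epsilon> - hnorm z \<in> hyp_pos" if "real_norm z < e" for z
      using \<epsilon> that by (auto simp: hyp_pos_iff bc_proj_hnorm e_def real_norm_def)
    then show "\<exists>n0. \<forall>m\<ge>n0. \<forall>n\<ge>n0. \<epsilon> - hnorm (s m - s n) \<in> hyp_pos"
      using n0 by blast
  qed
  then show "\<exists>x. (\<lambda>n. real_norm (s n - x)) \<longlonglongrightarrow> 0"
    using complete by (simp add: hn_tendsto_iff_real_norm)
qed

section \<open>Boundedness and openness of the map\<close>

theorem theorem4p6:
  fixes scaleX :: "bicomplex \<Rightarrow> 'a::ab_group_add \<Rightarrow> 'a"
    and scaleY :: "bicomplex \<Rightarrow> 'b::ab_group_add \<Rightarrow> 'b"
    and hnX :: "'a \<Rightarrow> bicomplex" and hnY :: "'b \<Rightarrow> bicomplex"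
    and T :: "'a \<Rightarrow> 'b"
  assumes "F_BC_module scaleX hnX"
    and "F_BC_module scaleY hnY"
    and "module_hom scaleX scaleY T"
    and "surj T"
    and "closed_graph_map hnX hnY T"
  shows "D_bounded hnX hnY T \<and> open_map (hn_topology hnX) (hn_topology hnY) T"
proof
  interpret X: F_BC_module scaleX hnX by fact
  interpret Y: F_BC_module scaleY hnY by fact
  interpret T: module_hom scaleX scaleY T by fact
  note normed = X.complete_normed_vs_real_norm Y.complete_normed_vs_real_norm
  have closed: "T x = y" if "(\<lambda>n. X.real_norm (s n - x)) \<longlonglongrightarrow> 0"
    "(\<lambda>n. Y.real_norm (T (s n) - y)) \<longlonglongrightarrow> 0" for s x y
    using assms(5) that
    unfolding closed_graph_map_def X.hn_tendsto_iff_real_norm Y.hn_tendsto_iff_real_norm by blast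
  show "D_bounded hnX hnY T"
  proof -
    \<comment> \<open>The graph is single-valued, so the selected \<open>y\<close> is
      \<open>T x\<close> and the bound holds for \<open>T\<close> itself.\<close>
    have "\<exists>C\<ge>0. \<forall>x. \<exists>y. (x, y) \<in> {(x, T x) | x. True} \<and> Y.real_norm y \<le> C * X.real_norm x"
    proof (rule closed_relation_bounded_selection[OF normed])
      fix s t x y
      assume "\<And>n. (s n, t n) \<in> {(x, T x) | x. True}" and
        lim: "(\<lambda>n. X.real_norm (s n - x)) \<longlonglongrightarrow> 0" "(\<lambda>n. Y.real_norm (t n - y)) \<longlonglongrightarrow> 0"
      then have "t = (\<lambda>n. T (s n))"
        by auto
      then show "(x, y) \<in> {(x, T x) | x. True}"
        using closed lim by auto
    qed (auto simp: T.add T.scale X.real_scale_def Y.real_scale_def)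
    then obtain C where C: "C \<ge> 0" "\<And>x. Y.real_norm (T x) \<le> C * X.real_norm x"
      by auto
    \<comment> \<open>\<open>T\<close> commutes with \<open>bc_e1\<close> and \<open>bc_e2\<close>,
      so testing the bound on \<open>bc_e1 x\<close> and \<open>bc_e2 x\<close> separates the
      components.\<close>
    have le: "Y.hn1 (T x) \<le> C * X.hn1 x" "Y.hn2 (T x) \<le> C * X.hn2 x" for x
      using C(2)[of "scaleX bc_e1 x"] C(2)[of "scaleX bc_e2 x"]
      by (simp_all add: T.scale X.real_norm_idempotent Y.real_norm_idempotent)
    have proj: "bc_proj1 (bc_of_real C) = of_real C" "bc_proj2 (bc_of_real C) = of_real C"
      by (simp_all add: bc_proj1_def bc_proj2_def bc_of_complex_def)
    show ?thesis
      unfolding D_bounded_def hyp_le_def hyp_nonneg_iff hyperbolic_iff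
      by (intro bexI[of _ "bc_of_real C"])
        (auto simp: hyp_nonneg_iff proj C(1) X.bc_proj_hnorm Y.bc_proj_hnorm le)
  qed
  show "open_map (hn_topology hnX) (hn_topology hnY) T"
  proof -
    \<comment> \<open>Surjectivity makes the converse graph total. The selection then provides
      preimages of controlled norm.\<close>
    have "\<exists>C\<ge>0. \<forall>y. \<exists>x. (y, x) \<in> {(T x, x) | x. True} \<and> X.real_norm x \<le> C * Y.real_norm y"
    proof (rule closed_relation_bounded_selection[OF normed(2,1)])
      fix s t y x
      assume "\<And>n. (s n, t n) \<in> {(T x, x) | x. True}" and
        lim: "(\<lambda>n. Y.real_norm (s n - y)) \<longlonglongrightarrow> 0" "(\<lambda>n. X.real_norm (t n - x)) \<longlonglongrightarrow> 0"
      then have "s = (\<lambda>n. T (t n))"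
        by auto
      then show "(y, x) \<in> {(T x, x) | x. True}"
        using closed lim by auto
    next
      show "Domain {(T x, x) | x. True} = UNIV"
        using \<open>surj T\<close> by (auto simp: Domain_iff surj_def)
    qed (auto simp: T.add T.scale X.real_scale_def Y.real_scale_def)
    then obtain C where C: "C \<ge> 0" "\<And>y. \<exists>x. y = T x \<and> X.real_norm x \<le> C * Y.real_norm y"
      by auto
    show ?thesis
      unfolding open_map_def Y.openin_hn_topology_iff_real_norm
    proof (intro allI impI ballI)
      fix U v assume U: "openin (hn_topology hnX) U" and "v \<in> T ` U"
      then obtain u where u: "u \<in> U" "v = T u"
        by blast
      obtain d where d: "d > 0" "\<And>x. X.real_norm (x - u) < d \<Longrightarrow> x \<in> U"
        using U u unfolding X.openin_hn_topology_iff_real_norm by blast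
      \<comment> \<open>A controlled preimage of \<open>w - v\<close> is added to \<open>u\<close>.
        The denominator \<open>C + 1\<close> covers the case \<open>C = 0\<close> and makes the
        final inequality strict.\<close>
      have "w \<in> T ` U" if w: "Y.real_norm (w - v) < d / (C + 1)" for w
      proof -
        obtain x where x: "w - v = T x" "X.real_norm x \<le> C * Y.real_norm (w - v)"
          using C(2) by blast
        have "C * Y.real_norm (w - v) \<le> C * (d / (C + 1))"
          using w C(1) by (intro mult_left_mono) auto
        also have "\<dots> < d"
          using C(1) d(1) by (simp add: field_simps)
        finally have "u + x \<in> U"
          using x d(2)[of "u + x"] by simp
        moreover have "T (u + x) = w"
          using x(1)[symmetric] u by (simp add: T.add)
        ultimately show ?thesis
          by blast
      qed
      then show "\<exists>d>0. \<forall>y. Y.real_norm (y - v) < d \<longrightarrow> y \<in> T ` U"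
        using C(1) d(1) by (intro exI[of _ "d / (C + 1)"]) auto
    qed
  qed
qed

end
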